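(* Let $(P(n))_{n\ge1}$ be integers and $(b_k)_{k\ge1}$ complex numbers satisfying, as formal power series, $$1+\sum_{n=1}^\infty P(n)q^n=\prod_{k=1}^\infty(1-q^k)^{-b_k}.$$ Let $p$ be a prime and $r$ a positive integer such that $p^r\mid P(n)$ for all $n\ge1$. Then (all $b_m$ are integers and) for every $m\ge1$: (a) if $\gcd(p,m)=1$, then $p^r\mid b_m$; (b) if $p\mid m$, then $p^{r-1}\mid b_m$.
   Context: For complex $b$, $(1-x)^{-b}=\sum_{r\ge0}\frac{(b)_r}{r!}x^r$ as a formal power series, where $(b)_r=b(b+1)\cdots(b+r-1)$. *)

theory Defs
  imports "HOL-Analysis.Analysis"
begin

text \<open>The formal power series \<open>(1 - X)\<close> to the power \<open>-b\<close>.\<close>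

definition fps_geom_powr :: "complex \<Rightarrow> complex fps" where
  "fps_geom_powr b = Abs_fps (\<lambda>r. pochhammer b r / fact r)"

text \<open>
  The factor of index \<open>k\<close> is \<open>(1 - X ^ k)\<close> to the power \<open>- b k\<close>. The composition \<open>oo\<close> is
  the usual substitution only when the inner series has zero constant term, i.e. for \<open>k \<ge> 1\<close>.
\<close>

definition euler_factor :: "(nat \<Rightarrow> complex) \<Rightarrow> nat \<Rightarrow> complex fps" where
  "euler_factor b k = fps_geom_powr (b k) oo (fps_X ^ k)"

end

theory Submission
  imports Defs
begin

text \<open>
  Put \<open>A n = (\<Sum>d | d dvd n. d * b d)\<close>, so that \<open>A n / n\<close> is the coefficient of \<open>X ^ n\<close> in the
  logarithm of the product. The product has the form \<open>1 + p ^ r * G\<close> with \<open>G\<close> integral, and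
  \<open>p ^ (r * i) / i\<close> has \<open>p\<close>-adic valuation at least \<open>r\<close>; hence \<open>n * p ^ r\<close> divides \<open>A n\<close> \<open>p\<close>-adically.
  For \<open>m = p ^ k * e\<close> with \<open>k > 0\<close> and \<open>e\<close> prime to \<open>p\<close>, the difference \<open>A m - A (m / p)\<close> is the sum of
  \<open>d * b d\<close> over the divisors \<open>d = p ^ k * f\<close>, \<open>f dvd e\<close>, and the divisibility of \<open>b m\<close> follows by
  induction on \<open>e\<close>. The \<open>b m\<close> are integers because the coefficient of \<open>X ^ m\<close> in the product is
  \<open>b m\<close> plus an integer-valued polynomial in the \<open>b j\<close>, \<open>j < m\<close>.
\<close>

unbundle no vec_syntax and fps_syntax

section \<open>Integral power series\<close>

definition fps_Ints :: "'a::comm_ring_1 fps \<Rightarrow> bool" where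
  "fps_Ints f \<longleftrightarrow> (\<forall>n. f $ n \<in> \<int>)"

lemma fps_Ints_1: "fps_Ints 1"
  by (simp add: fps_Ints_def)

lemma fps_Ints_mult: "fps_Ints f \<Longrightarrow> fps_Ints g \<Longrightarrow> fps_Ints (f * g)"
  unfolding fps_Ints_def fps_mult_nth by (intro allI Ints_sum Ints_mult) auto

lemma fps_Ints_power: "fps_Ints f \<Longrightarrow> fps_Ints (f ^ n)"
  by (induction n) (auto simp: fps_Ints_1 fps_Ints_mult)

lemma fps_Ints_prod: "(\<And>i. i \<in> S \<Longrightarrow> fps_Ints (f i)) \<Longrightarrow> fps_Ints (prod f S)"
  by (induction S rule: infinite_finite_induct) (auto simp: fps_Ints_1 fps_Ints_mult)

section \<open>The Euler factors\<close>

lemma fps_compose_X_power_nth: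
  assumes "k > 0"
  shows "(f oo fps_X ^ k) $ n = (if k dvd n then f $ (n div k) else 0)"
proof -
  have "(f oo fps_X ^ k) $ n = (\<Sum>i\<in>{0..n}. if n = k * i then f $ i else 0)"
    unfolding fps_compose_nth by (intro sum.cong) (auto simp flip: power_mult)
  also have "\<dots> = (\<Sum>i\<in>{0..n}. if n div k = i then (if k dvd n then f $ i else 0) else 0)"
    using assms by (intro sum.cong) auto
  also have "\<dots> = (if k dvd n then f $ (n div k) else 0)"
    by simp
  finally show ?thesis .
qed

lemma euler_factor_nth:
  assumes "k > 0"
  shows "euler_factor b k $ n =
    (if k dvd n then pochhammer (b k) (n div k) / fact (n div k) else 0)"
  using assms by (simp add: euler_factor_def fps_geom_powr_def fps_compose_X_power_nth)

lemma euler_factor_Ints: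
  assumes "k > 0" "b k \<in> \<int>"
  shows "fps_Ints (euler_factor b k)"
proof -
  obtain c where c: "b k = of_int c"
    using assms(2) Ints_cases by blast
  have "pochhammer (b k) m / fact m \<in> \<int>" for m
  proof -
    have "(fact m :: int) dvd pochhammer c m"
      by (rule fact_dvd_pochhammer)
    then obtain d where "pochhammer c m = fact m * d" ..
    then have "pochhammer (b k) m = fact m * of_int d"
      by (metis c of_int_fact of_int_mult pochhammer_of_int)
    then show ?thesis by simp
  qed
  then show ?thesis
    using assms(1) by (simp add: fps_Ints_def euler_factor_nth)
qed

text \<open>The recursion (b)_(i+1) = (b)_i (b + i), read coefficientwise, is the differential
  equation that determines (1 - X)^(-b) up to a constant factor. It supplies the logarithmic
  derivative of the Euler factors.\<close>

lemma fps_geom_powr_deriv: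
  "(1 - fps_X) * fps_deriv (fps_geom_powr b) = fps_const b * fps_geom_powr b"
proof (rule fps_ext)
  fix n
  have deriv: "fps_deriv (fps_geom_powr b) $ i = (b + of_nat i) * fps_geom_powr b $ i" for i
  proof -
    have "(of_nat (i + 1) :: complex) \<noteq> 0"
      unfolding of_nat_eq_0_iff by simp
    then show ?thesis
      by (simp add: fps_geom_powr_def pochhammer_Suc field_simps del: of_nat_Suc of_nat_add)
  qed
  have "(fps_X * fps_deriv (fps_geom_powr b)) $ n = of_nat n * fps_geom_powr b $ n"
    by (cases n) (simp_all del: of_nat_Suc)
  then show "((1 - fps_X) * fps_deriv (fps_geom_powr b)) $ n = (fps_const b * fps_geom_powr b) $ n"
    unfolding left_diff_distrib mult_1_left fps_sub_nth deriv by (simp add: algebra_simps)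
qed

text \<open>X d/dX log of (1 - X^k)^(-b) is k b X^k / (1 - X^k), and the second factor on the right
  is its geometric expansion. Both sides are compared after multiplication by 1 - X^k, which is then
  cancelled, so no inverse series occurs.\<close>

lemma euler_factor_log_deriv:
  assumes "k > 0"
  shows "fps_X * fps_deriv (euler_factor b k) =
    euler_factor b k * Abs_fps (\<lambda>n. if n > 0 \<and> k dvd n then of_nat k * b k else 0)"
    (is "_ = ?E * ?W")
proof -
  let ?g = "fps_geom_powr (b k)" and ?y = "fps_X ^ k :: complex fps"
  have y0: "?y $ 0 = 0"
    using assms by simp
  have g: "(1 - ?y) * (fps_deriv ?g oo ?y) = fps_const (b k) * ?E"
    using arg_cong[OF fps_geom_powr_deriv[of "b k"], of "\<lambda>f. f oo ?y"] y0 assms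
    by (simp add: fps_compose_mult_distrib fps_compose_sub_distrib euler_factor_def)
  have E: "fps_X * fps_deriv ?E = (fps_deriv ?g oo ?y) * (fps_const (of_nat k) * ?y)"
  proof -
    have "fps_X * fps_deriv ?y = fps_const (of_nat k) * ?y"
    proof (rule fps_ext)
      fix n
      show "(fps_X * fps_deriv ?y) $ n = (fps_const (of_nat k) * ?y) $ n"
        using assms by (cases n) auto
    qed
    then show ?thesis
      unfolding euler_factor_def fps_compose_deriv[OF y0] by (simp only: mult.left_commute[of fps_X])
  qed
  have W: "(1 - ?y) * ?W = fps_const (of_nat k * b k) * ?y"
  proof (rule fps_ext)
    fix n
    show "((1 - ?y) * ?W) $ n = (fps_const (of_nat k * b k) * ?y) $ n"
      using assms
      by (auto simp: left_diff_distrib fps_X_power_mult_nth dvd_imp_le dest: dvd_diffD)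
  qed
  have "(1 - ?y) * (fps_X * fps_deriv ?E) =
      (1 - ?y) * (fps_deriv ?g oo ?y) * (fps_const (of_nat k) * ?y)"
    unfolding E by (simp only: mult.assoc)
  also have "\<dots> = ?E * (fps_const (of_nat k * b k) * ?y)"
    unfolding g fps_const_mult[symmetric] by (simp only: mult_ac)
  also have "\<dots> = (1 - ?y) * (?E * ?W)"
    unfolding W[symmetric] by (simp only: mult.left_commute)
  finally have "(1 - ?y) * (fps_X * fps_deriv ?E) = (1 - ?y) * (?E * ?W)" .
  moreover have "1 - ?y \<noteq> 0"
  proof
    assume "1 - ?y = 0"
    then have "(1 - ?y) $ 0 = 0"
      by (simp only: fps_zero_nth)
    then show False
      using y0 by simp
  qed
  ultimately show ?thesis by simp
qed

section \<open>Finite partial products of the Euler product\<close>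

definition euler_partial :: "(nat \<Rightarrow> complex) \<Rightarrow> nat \<Rightarrow> complex fps" where
  "euler_partial b N = (\<Prod>k=1..N. euler_factor b k)"

lemma euler_partial_Suc: "euler_partial b (Suc N) = euler_partial b N * euler_factor b (Suc N)"
  by (simp add: euler_partial_def)

lemma euler_partial_nth_0: "euler_partial b N $ 0 = 1"
  by (induction N) (simp_all add: euler_partial_Suc euler_factor_nth, simp add: euler_partial_def)

lemma euler_partial_Ints:
  assumes "\<And>k. 0 < k \<Longrightarrow> k \<le> N \<Longrightarrow> b k \<in> \<int>"
  shows "fps_Ints (euler_partial b N)"
  unfolding euler_partial_def using assms by (intro fps_Ints_prod euler_factor_Ints) auto

text \<open>Up to degree N + 1 the new factor is just 1 + b_(N+1) X^(N+1). This yields both the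
  stability of the lower coefficients and the recursion that recovers b_(N+1) from the
  product.\<close>

lemma euler_partial_Suc_nth:
  assumes "n \<le> Suc N"
  shows "euler_partial b (Suc N) $ n =
    euler_partial b N $ n + (if n = Suc N then b (Suc N) else 0)"
proof -
  let ?Q = "euler_partial b N" and ?E = "euler_factor b (Suc N)"
  have E: "?E $ i = (if i = 0 then 1 else if i = Suc N then b (Suc N) else 0)" if "i \<le> Suc N" for i
    using that by (auto simp: euler_factor_nth dest: dvd_imp_le)
  have "euler_partial b (Suc N) $ n = (\<Sum>i=0..n. ?E $ i * ?Q $ (n - i))"
    unfolding euler_partial_Suc mult.commute[of ?Q] fps_mult_nth ..
  also have "\<dots> = (\<Sum>i=0..n. (if i = 0 then ?Q $ n else 0) +
      (if i = Suc N then ?Q $ (n - Suc N) * b (Suc N) else 0))"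
    using assms by (intro sum.cong) (auto simp: E)
  also have "\<dots> = ?Q $ n + (if n = Suc N then b (Suc N) else 0)"
    using assms by (auto simp: sum.distrib euler_partial_nth_0)
  finally show ?thesis .
qed

lemma euler_partial_stable: "n \<le> N \<Longrightarrow> euler_partial b N $ n = euler_partial b n $ n"
  by (induction N rule: dec_induct) (auto simp: euler_partial_Suc_nth)

text \<open>Logarithmic derivatives of the factors add up. The condition \<open>0 < n\<close>
  matters: every \<open>d\<close> divides 0, yet the constant term has to vanish.\<close>

lemma euler_partial_log_deriv:
  "fps_X * fps_deriv (euler_partial b N) =
    euler_partial b N * Abs_fps (\<lambda>n. \<Sum>d | d dvd n \<and> 0 < n \<and> d \<le> N. of_nat d * b d)"
proof (induction N)
  case 0
  have "{d. d dvd n \<and> 0 < n \<and> d = 0} = {}" for n :: nat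
    by auto
  then show ?case
    by (simp add: euler_partial_def fps_eq_iff)
next
  case (Suc N)
  let ?A = "\<lambda>N. Abs_fps (\<lambda>n. \<Sum>d | d dvd n \<and> 0 < n \<and> d \<le> N. of_nat d * b d)"
  let ?W = "Abs_fps (\<lambda>n. if n > 0 \<and> Suc N dvd n then of_nat (Suc N) * b (Suc N) else 0)"
  have A: "?A (Suc N) = ?A N + ?W"
  proof (rule fps_ext)
    fix n
    have "{d. d dvd n \<and> 0 < n \<and> d \<le> Suc N} = {d. d dvd n \<and> 0 < n \<and> d \<le> N} \<union>
        (if n > 0 \<and> Suc N dvd n then {Suc N} else {})"
      by (auto simp: le_Suc_eq)
    then show "?A (Suc N) $ n = (?A N + ?W) $ n"
      by (simp del: of_nat_Suc)
  qed
  have "fps_X * fps_deriv (euler_partial b N * euler_factor b (Suc N)) =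
      fps_X * fps_deriv (euler_partial b N) * euler_factor b (Suc N) +
      euler_partial b N * (fps_X * fps_deriv (euler_factor b (Suc N)))"
    by (simp add: algebra_simps)
  also have "\<dots> = euler_partial b N * ?A N * euler_factor b (Suc N) +
      euler_partial b N * (euler_factor b (Suc N) * ?W)"
    by (simp only: Suc.IH euler_factor_log_deriv[OF zero_less_Suc])
  also have "\<dots> = euler_partial b N * euler_factor b (Suc N) * (?A N + ?W)"
    by (simp only: distrib_left mult_ac)
  finally show ?case
    unfolding euler_partial_Suc A .
qed

section \<open>The infinite product\<close>

lemma has_prod_euler_factor_nth:
  assumes "(\<lambda>k. euler_factor b (Suc k)) has_prod F" "F $ 0 = 1" "n \<le> N"
  shows "F $ n = euler_partial b N $ n"
proof -
  \<comment> \<open>\<open>has_prod\<close> also admits the value 0 when some factor vanishes; a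
    nonzero \<open>F\<close> leaves only convergence of the partial products themselves.\<close>
  have "F \<noteq> 0"
    using assms(2) by auto
  then have "(\<lambda>N. \<Prod>k\<le>N. euler_factor b (Suc k)) \<longlonglongrightarrow> F"
    using assms(1) by (auto simp: has_prod_def raw_has_prod_def)
  moreover have "(\<Prod>k\<le>N. euler_factor b (Suc k)) = euler_partial b (Suc N)" for N
    by (induction N) (simp_all add: euler_partial_def)
  \<comment> \<open>Convergence of formal power series means that each coefficient is eventually
    constant.\<close>
  ultimately have "eventually (\<lambda>N. euler_partial b (Suc N) $ n = F $ n) sequentially"
    by (simp add: tendsto_fps_iff)
  then obtain M where "\<And>N. N \<ge> M \<Longrightarrow> euler_partial b (Suc N) $ n = F $ n"
    by (auto simp: eventually_sequentially)
  from this[of "max M N"] have "F $ n = euler_partial b (Suc (max M N)) $ n"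
    by simp
  also have "\<dots> = euler_partial b N $ n"
    using assms(3) euler_partial_stable[of n "Suc (max M N)" b] euler_partial_stable[of n N b] by simp
  finally show ?thesis .
qed

text \<open>Coefficients up to degree n involve only factors of index at most n, so F can be
  exchanged for the n-th partial product, where the bound \<open>d \<le> n\<close> on the divisors
  is automatic.\<close>

lemma has_prod_euler_factor_log_deriv:
  assumes "(\<lambda>k. euler_factor b (Suc k)) has_prod F" "F $ 0 = 1"
  shows "fps_X * fps_deriv F = F * Abs_fps (\<lambda>n. \<Sum>d | d dvd n \<and> 0 < n. of_nat d * b d)"
    (is "_ = F * ?A")
proof (rule fps_ext)
  fix n
  let ?Q = "euler_partial b n"
  let ?B = "Abs_fps (\<lambda>j. \<Sum>d | d dvd j \<and> 0 < j \<and> d \<le> n. of_nat d * b d)"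
  have F: "F $ i = ?Q $ i" if "i \<le> n" for i
    using has_prod_euler_factor_nth[OF assms that] .
  have "{d. d dvd j \<and> 0 < j} = {d. d dvd j \<and> 0 < j \<and> d \<le> n}" if "j \<le> n" for j
    using that dvd_imp_le le_trans by blast
  then have A: "?A $ j = ?B $ j" if "j \<le> n" for j
    using that by simp
  have "(fps_X * fps_deriv F) $ n = (fps_X * fps_deriv ?Q) $ n"
    by (cases n) (auto simp: F)
  also have "\<dots> = (?Q * ?B) $ n"
    by (simp only: euler_partial_log_deriv)
  also have "\<dots> = (F * ?A) $ n"
    unfolding fps_mult_nth by (intro sum.cong) (auto simp: F A simp del: fps_nth_Abs_fps)
  finally show "(fps_X * fps_deriv F) $ n = (F * ?A) $ n" .
qed

lemma has_prod_euler_factor_Ints: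
  assumes "(\<lambda>k. euler_factor b (Suc k)) has_prod F" "F $ 0 = 1" "fps_Ints F" "m > 0"
  shows "b m \<in> \<int>"
  using assms(4)
proof (induction m rule: less_induct)
  case (less m)
  then obtain N where m: "m = Suc N"
    by (cases m) auto
  have "b m = F $ m - euler_partial b N $ m"
    using has_prod_euler_factor_nth[OF assms(1,2) order_refl, of m] euler_partial_Suc_nth[of m N b] m
    by simp
  moreover have "fps_Ints (euler_partial b N)"
    by (rule euler_partial_Ints) (use less m in auto)
  ultimately show ?case
    using assms(3) by (simp add: fps_Ints_def)
qed

section \<open>The logarithm of the product\<close>

lemma fps_ln_compose_deriv:
  fixes F :: "'a::field_char_0 fps"
  assumes "F $ 0 = 1"
  shows "F * fps_deriv (fps_ln 1 oo (F - 1)) = fps_deriv F"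
proof -
  have u0: "(F - 1) $ 0 = 0"
    using assms by simp
  \<comment> \<open>\<open>fps_ln 1\<close> is log(1 + X); its derivative 1/(1 + X) becomes 1/F when
    F - 1 is substituted for X, and the chain rule does the rest.\<close>
  have "inverse (1 + fps_X) oo (F - 1) = inverse F"
    using fps_inverse_compose[OF u0, of "1 + fps_X"] u0 by (simp add: fps_compose_add_distrib)
  then have "fps_deriv (fps_ln 1 oo (F - 1)) = inverse F * fps_deriv F"
    unfolding fps_compose_deriv[OF u0] by (simp add: fps_ln_deriv)
  moreover have "F * inverse F = 1"
    using assms by (simp add: inverse_mult_eq_1')
  ultimately show ?thesis
    by (simp flip: mult.assoc)
qed

lemma has_prod_euler_factor_ln:
  assumes "(\<lambda>k. euler_factor b (Suc k)) has_prod F" "F $ 0 = 1" "n > 0"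
  shows "(\<Sum>d | d dvd n. of_nat d * b d) = of_nat n * (fps_ln 1 oo (F - 1)) $ n"
proof -
  let ?A = "Abs_fps (\<lambda>n. \<Sum>d | d dvd n \<and> 0 < n. of_nat d * b d)"
  let ?L = "fps_ln 1 oo (F - 1)"
  have "F * ?A = F * (fps_X * fps_deriv ?L)"
    using has_prod_euler_factor_log_deriv[OF assms(1,2)] fps_ln_compose_deriv[OF assms(2)]
    by (metis mult.left_commute)
  moreover have "F \<noteq> 0"
    using assms(2) by auto
  ultimately have "?A = fps_X * fps_deriv ?L"
    by simp
  then have "?A $ n = (fps_X * fps_deriv ?L) $ n"
    by (rule arg_cong)
  then show ?thesis
    using assms(3) by (cases n) (simp_all del: of_nat_Suc)
qed

section \<open>Divisibility\<close>

text \<open>For prime \<open>p\<close> and a field of characteristic 0 this is membership in the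
  localization of the integers at \<open>p\<close>. Clearing the denominator lets it be stated
  directly for complex numbers.\<close>

definition p_integral :: "nat \<Rightarrow> 'a::comm_ring_1 \<Rightarrow> bool" where
  "p_integral p z \<longleftrightarrow> (\<exists>s a::int. \<not> int p dvd s \<and> of_int s * z = of_int a)"

lemma p_integral_add:
  assumes "prime p" "p_integral p x" "p_integral p y"
  shows "p_integral p (x + y)"
proof -
  obtain s a t c where st: "\<not> int p dvd s" "\<not> int p dvd t"
    and eq: "of_int s * x = of_int a" "of_int t * y = of_int c"
    using assms(2,3) unfolding p_integral_def by blast
  have "of_int (s * t) * (x + y) = of_int t * (of_int s * x) + of_int s * (of_int t * y)"
    by (simp add: algebra_simps)
  also have "\<dots> = of_int (t * a + s * c)"
    by (simp add: eq)
  finally show ?thesis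
    unfolding p_integral_def using st assms(1) by (metis prime_dvd_mult_iff prime_nat_int_transfer)
qed

lemma p_integral_sum:
  assumes "prime p" "\<And>i. i \<in> S \<Longrightarrow> p_integral p (f i)"
  shows "p_integral p (sum f S)"
proof -
  have "p_integral p 0"
    using assms(1) prime_gt_1_nat[OF assms(1)] unfolding p_integral_def
    by (intro exI[of _ 1] exI[of _ 0]) auto
  then show ?thesis
    using assms by (induction S rule: infinite_finite_induct) (auto intro: p_integral_add)
qed

lemma p_integral_mult_Ints:
  assumes "p_integral p x" "y \<in> \<int>"
  shows "p_integral p (x * y)"
proof -
  obtain s a c where "\<not> int p dvd s" "of_int s * x = of_int a" "y = of_int c"
    using assms unfolding p_integral_def by (auto elim!: Ints_cases)
  then show ?thesis
    unfolding p_integral_def by (metis mult.assoc of_int_mult)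
qed

text \<open>If v is the p-adic valuation of i, then v < 2^v \<le> p^v \<le> i, so v \<le> i - 1
  \<le> r (i - 1). The exponent is not r i because one factor p^r is set aside in the estimate of
  the logarithm.\<close>

lemma p_integral_power_div:
  assumes "prime p" "r > 0" "i > 0"
  shows "p_integral p (of_nat p ^ (r * (i - 1)) / of_nat i :: 'a::field_char_0)"
proof -
  obtain s where s: "i = p ^ multiplicity p i * s" "\<not> p dvd s"
    using assms multiplicity_decompose'[of i p] by (metis not_prime_unit less_irrefl)
  let ?v = "multiplicity p i"
  have "?v < 2 ^ ?v"
    by simp
  also have "\<dots> \<le> p ^ ?v"
    using prime_ge_2_nat[OF assms(1)] by (intro power_mono) auto
  also have "\<dots> \<le> i"
    using assms(3) by (intro dvd_imp_le multiplicity_dvd)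
  finally have "?v \<le> i - 1"
    by simp
  also have "\<dots> \<le> r * (i - 1)"
    using assms(2) by simp
  finally have v: "?v \<le> r * (i - 1)" .
  have "of_nat s * (of_nat p ^ (r * (i - 1)) / of_nat i) =
      (of_nat s * of_nat p ^ ?v * of_nat p ^ (r * (i - 1) - ?v) / of_nat i :: 'a)"
    using v by (simp add: mult.assoc flip: power_add)
  also have "of_nat s * of_nat p ^ ?v = (of_nat i :: 'a)"
    by (metis s(1) mult.commute of_nat_mult of_nat_power)
  finally show ?thesis
    unfolding p_integral_def using s(2) assms(3)
    by (intro exI[of _ "int s"] exI[of _ "int p ^ (r * (i - 1) - ?v)"]) simp
qed

lemma p_integral_ln_one_plus:
  fixes G :: "'a::field_char_0 fps"
  assumes "prime p" "r > 0" "fps_Ints G"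
  shows "p_integral p ((fps_ln 1 oo (fps_const (of_nat p ^ r) * G)) $ n / of_nat p ^ r)"
proof -
  \<comment> \<open>The i-th term of log(1 + p^r G) with one factor p^r already divided out.\<close>
  let ?f = "\<lambda>i. of_nat p ^ (r * (i - 1)) / of_nat i * ((- 1) ^ (i - 1) * (G ^ i) $ n) :: 'a"
  have p: "of_nat p \<noteq> (0 :: 'a)"
    using assms(1) by auto
  have *: "fps_ln 1 $ i * (fps_const (of_nat p ^ r) * G) ^ i $ n / of_nat p ^ r =
      (if i = 0 then 0 else ?f i)" for i
  proof (cases i)
    case (Suc j)
    have "(fps_const (of_nat p ^ r) * G) ^ i $ n = (of_nat p ^ r) ^ i * (G ^ i) $ n"
      by (simp add: power_mult_distrib)
    then show ?thesis
      using p Suc by (simp add: fps_ln_nth power_mult del: of_nat_Suc power_Suc)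
        (simp add: field_simps del: of_nat_Suc)
  qed (simp add: fps_ln_nth)
  have "(fps_ln 1 oo (fps_const (of_nat p ^ r) * G)) $ n / of_nat p ^ r =
      (\<Sum>i\<in>{0..n}. if i = 0 then 0 else ?f i)"
    unfolding fps_compose_nth sum_divide_distrib * ..
  also have "\<dots> = (\<Sum>i\<in>{1..n}. ?f i)"
    by (rule sum.mono_neutral_cong_right) auto
  finally have eq: "(fps_ln 1 oo (fps_const (of_nat p ^ r) * G)) $ n / of_nat p ^ r =
      (\<Sum>i\<in>{1..n}. ?f i)" .
  have "(G ^ i) $ n \<in> \<int>" for i
    using fps_Ints_power[OF assms(3)] unfolding fps_Ints_def by blast
  then show ?thesis
    unfolding eq using assms(1,2)
    by (intro p_integral_sum p_integral_mult_Ints p_integral_power_div) auto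
qed

section \<open>From divisor sums back to single summands\<close>

lemma divisor_sum_diff:
  fixes f :: "nat \<Rightarrow> 'a::ab_group_add"
  assumes "prime p" "\<not> p dvd e"
  shows "(\<Sum>d | d dvd e. f (p ^ k * d)) = (\<Sum>d | d dvd p ^ k * e. f d) -
    (if k = 0 then 0 else \<Sum>d | d dvd p ^ (k - 1) * e. f d)"
proof (cases k)
  case (Suc j)
  have p0: "p > 0" and e0: "e > 0"
    using assms by (auto simp: prime_gt_0_nat intro: gr0I)
  let ?D = "{d. d dvd p ^ k * e}" and ?D' = "{d. d dvd p ^ j * e}"
  have fin: "finite ?D"
    using p0 e0 by simp
  have sub: "?D' \<subseteq> ?D"
    unfolding Suc by (auto intro: dvd_trans)
  \<comment> \<open>A divisor p^i y of p^k e, with y dividing e, fails to divide p^(k-1) e exactly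
    when i = k.\<close>
  have "?D - ?D' = (*) (p ^ k) ` {d. d dvd e}"
  proof (intro equalityI subsetI)
    fix d assume d: "d \<in> ?D - ?D'"
    then obtain x y where xy: "d = x * y" "x dvd p ^ k" "y dvd e"
      by (auto elim: dvd_productE)
    obtain i where i: "i \<le> k" "x = p ^ i"
      using xy(2) assms(1) divides_primepow_nat by blast
    have "i = k"
    proof (rule ccontr)
      assume "i \<noteq> k"
      then have "x dvd p ^ j"
        using i Suc by (simp add: le_imp_power_dvd)
      then show False
        using d xy mult_dvd_mono by blast
    qed
    then show "d \<in> (*) (p ^ k) ` {d. d dvd e}"
      using xy i by blast
  next
    fix d assume "d \<in> (*) (p ^ k) ` {d. d dvd e}"
    then obtain y where y: "d = p ^ k * y" "y dvd e"
      by blast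
    have "\<not> p ^ k * y dvd p ^ j * e"
    proof
      assume "p ^ k * y dvd p ^ j * e"
      then have "p * y dvd e"
        using p0 by (simp add: Suc mult.assoc mult.left_commute[of p])
      then show False
        using assms(2) dvd_mult_left by blast
    qed
    then show "d \<in> ?D - ?D'"
      using y by simp
  qed
  moreover have "inj_on ((*) (p ^ k)) {d. d dvd e}"
    using p0 by (auto intro: inj_onI)
  ultimately have "(\<Sum>d | d dvd e. f (p ^ k * d)) = sum f (?D - ?D')"
    by (simp add: sum.reindex)
  also have "\<dots> = sum f ?D - sum f ?D'"
    using fin sub by (rule sum_diff)
  finally show ?thesis
    by (simp add: Suc)
qed simp

text \<open>The divisor sums at p^k e and p^(k-1) e are divisible by p^(r+k) and p^(r+k-1), so their
  difference keeps the smaller power. For k = 0 only one sum occurs, and the truncated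
  \<open>k - 1\<close> gives exponent r.\<close>

lemma prime_power_dvd_divisor_summand:
  fixes f :: "nat \<Rightarrow> int"
  assumes p: "prime p" and A: "\<And>n j. n > 0 \<Longrightarrow> p ^ j dvd n \<Longrightarrow> int p ^ (r + j) dvd (\<Sum>d | d dvd n. f d)"
    and e: "\<not> p dvd e"
  shows "int p ^ (r + (k - 1)) dvd f (p ^ k * e)"
  using e
proof (induction e rule: less_induct)
  case (less e)
  let ?q = "int p ^ (r + (k - 1))"
  have p0: "p > 0" and e0: "e > 0"
    using p less.prems by (auto simp: prime_gt_0_nat intro: gr0I)
  have dvd: "?q dvd (\<Sum>d | d dvd p ^ j * e. f d)" if "k - 1 \<le> j" for j
  proof -
    have "?q dvd int p ^ (r + j)"
      using that by (intro le_imp_power_dvd) simp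
    also have "\<dots> dvd (\<Sum>d | d dvd p ^ j * e. f d)"
      using p0 e0 by (intro A) auto
    finally show ?thesis .
  qed
  have "?q dvd (\<Sum>d | d dvd e. f (p ^ k * d))"
    unfolding divisor_sum_diff[OF p less.prems] using dvd[of k] dvd[of "k - 1"]
    by (cases "k = 0") (auto intro: dvd_diff)
  \<comment> \<open>The summand at d = e is isolated; the smaller divisors are again prime to p and
    fall under the induction hypothesis.\<close>
  also have "{d. d dvd e} = insert e {d. d dvd e \<and> d < e}"
    using e0 by (auto dest: dvd_imp_le)
  also have "(\<Sum>d\<in>\<dots>. f (p ^ k * d)) = f (p ^ k * e) + (\<Sum>d | d dvd e \<and> d < e. f (p ^ k * d))"
    by simp
  finally have "?q dvd f (p ^ k * e) + (\<Sum>d | d dvd e \<and> d < e. f (p ^ k * d))" .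
  moreover have "?q dvd (\<Sum>d | d dvd e \<and> d < e. f (p ^ k * d))"
    using less.prems by (intro dvd_sum less.IH) (auto dest: dvd_trans)
  ultimately show ?case
    by (simp add: dvd_add_left_iff)
qed

theorem theorem5p2:
  fixes P :: "nat \<Rightarrow> int" and b :: "nat \<Rightarrow> complex" and p r :: nat
  assumes "(\<lambda>k. euler_factor b (Suc k)) has_prod
             (1 + Abs_fps (\<lambda>n. if n = 0 then 0 else of_int (P n)))"
    and "prime p" and "r \<ge> 1"
    and "\<forall>n\<ge>1. int p ^ r dvd P n"
  shows "\<forall>m\<ge>1. \<exists>c::int. b m = of_int c
           \<and> (gcd p m = 1 \<longrightarrow> int p ^ r dvd c)
           \<and> (p dvd m \<longrightarrow> int p ^ (r - 1) dvd c)"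
proof (intro allI impI)
  let ?U = "Abs_fps (\<lambda>n. if n = 0 then 0 else of_int (P n)) :: complex fps"
  define F where "F = 1 + ?U"
  \<comment> \<open>Once b m is known to be an integer, this is that integer; \<open>Re\<close> is
    there because the floor is taken of a real number.\<close>
  define c where "c m = \<lfloor>Re (b m)\<rfloor>" for m
  note prod = assms(1)[folded F_def]
  have p0: "p > 0"
    using assms(2) by (rule prime_gt_0_nat)
  have F0: "F $ 0 = 1"
    by (simp add: F_def)
  have "fps_Ints F"
    by (simp add: F_def fps_Ints_def)
  then have b: "b m = of_int (c m)" if "m > 0" for m
    using has_prod_euler_factor_Ints[OF prod F0 _ that] by (auto simp: c_def elim!: Ints_cases)
  obtain Q where Q: "P n = int p ^ r * Q n" if "n \<ge> 1" for n
    using assms(4) unfolding dvd_def by metis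
  define G :: "complex fps" where "G = Abs_fps (\<lambda>n. if n = 0 then 0 else of_int (Q n))"
  have U: "F - 1 = fps_const (of_nat p ^ r) * G"
    by (simp add: F_def G_def fps_eq_iff Q)
  have G: "fps_Ints G"
    by (simp add: G_def fps_Ints_def)
  have A: "int p ^ (r + j) dvd (\<Sum>d | d dvd n. int d * c d)" if n: "n > 0" "p ^ j dvd n" for n j
  proof -
    let ?S = "\<Sum>d | d dvd n. int d * c d" and ?L = "(fps_ln 1 oo (F - 1)) $ n"
    have "of_int ?S = (\<Sum>d | d dvd n. of_nat d * b d)"
      using n by (auto simp: b dvd_pos_nat)
    also have "\<dots> = of_nat n * ?L"
      using prod F0 n(1) by (rule has_prod_euler_factor_ln)
    finally have S: "of_int ?S = of_nat n * ?L" .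
    have "p_integral p (?L / of_nat p ^ r)"
      unfolding U using assms(2,3) G by (intro p_integral_ln_one_plus) auto
    then obtain s a where s: "\<not> int p dvd s" and a: "of_int s * (?L / of_nat p ^ r) = of_int a"
      unfolding p_integral_def by blast
    \<comment> \<open>Multiplying by the denominator \<open>s\<close> turns the complex identity
      into one between integers; as \<open>s\<close> is prime to p, it drops out at the end.\<close>
    have "of_int (s * ?S) = of_nat n * of_nat p ^ r * (of_int s * (?L / of_nat p ^ r))"
      using p0 S by simp
    also have "\<dots> = of_int (int p ^ r * int n * a)"
      unfolding a by simp
    finally have "s * ?S = int p ^ r * int n * a"
      unfolding of_int_eq_iff .
    moreover have "int p ^ (r + j) dvd int p ^ r * int n"
      using n(2) unfolding power_add by (intro mult_dvd_mono) (auto simp flip: of_nat_power)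
    ultimately have "int p ^ (r + j) dvd s * ?S"
      by simp
    moreover have "coprime (int p ^ (r + j)) s"
      using s assms(2) by (auto intro!: coprime_power_left_iff[THEN iffD2] prime_imp_coprime)
    ultimately show ?thesis
      by (simp add: coprime_dvd_mult_right_iff)
  qed
  fix m :: nat assume m: "m \<ge> 1"
  define k where "k = multiplicity p m"
  obtain e where e: "m = p ^ k * e" "\<not> p dvd e"
    using assms(2) m multiplicity_decompose'[of m p] unfolding k_def
    by (metis not_prime_unit not_one_le_zero)
  have "int p ^ (r + (k - 1)) dvd int (p ^ k * e) * c (p ^ k * e)"
    using assms(2) A e(2) by (rule prime_power_dvd_divisor_summand)
  moreover have "int (p ^ k * e) * c (p ^ k * e) = int p ^ k * (int e * c m)"
    using e(1) by (simp add: mult.assoc[symmetric] flip: of_nat_power of_nat_mult)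
  ultimately have dvd: "int p ^ (r + (k - 1)) dvd int p ^ k * (int e * c m)"
    by (simp only:)
  have cop: "coprime (int p ^ i) (int e)" for i
    using e(2) assms(2) by (auto intro!: prime_imp_coprime)
  have "int p ^ r dvd c m" if "gcd p m = 1"
  proof -
    have "\<not> p dvd m"
      using that assms(2) by (metis gcd_nat.absorb1 not_prime_1)
    \<comment> \<open>Here the truncated \<open>k - 1\<close> is 0, so the full power p^r survives
      and only the factor e, prime to p, has to be removed.\<close>
    then have "k = 0"
      by (simp add: k_def not_dvd_imp_multiplicity_0)
    then show ?thesis
      using dvd cop by (simp add: coprime_dvd_mult_right_iff)
  qed
  moreover have "int p ^ (r - 1) dvd c m" if "p dvd m"
  proof -
    have "k > 0"
      using that assms(2) m by (simp add: k_def prime_multiplicity_gt_zero_iff)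
    \<comment> \<open>The factor p^k of m uses up k of the r + k - 1 powers of p, leaving r - 1.
      With truncated subtraction the identity relies on \<open>k > 0\<close> and
      \<open>r \<ge> 1\<close>.\<close>
    then have "r + (k - 1) = k + (r - 1)"
      using assms(3) by simp
    then have "int p ^ (r - 1) dvd int e * c m"
      using dvd p0 by (simp add: power_add)
    then show ?thesis
      by (rule coprime_dvd_mult_right_iff[OF cop, THEN iffD1])
  qed
  ultimately show "\<exists>c. b m = of_int c \<and> (gcd p m = 1 \<longrightarrow> int p ^ r dvd c)
      \<and> (p dvd m \<longrightarrow> int p ^ (r - 1) dvd c)"
    using b m by auto
qed

end
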